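(* Let $R\ge 1$ rollouts be sampled from a policy $\pi_\theta$ at a common initial state (prompt) $s_0$, where rollout $i\in\{1,\dots,R\}$ is $(s_0^{(i)},a_0^{(i)},\dots,s_{T_i-1}^{(i)},a_{T_i-1}^{(i)})$ with $s_0^{(i)}=s_0$ and length $T_i\ge 1$. Suppose the reward is output-only, i.e. $r(s_t^{(i)},a_t^{(i)})=0$ for all $t<T_i-1$ and $r(s_{T_i-1}^{(i)},a_{T_i-1}^{(i)})=r_i$ (the terminal reward of rollout $i$), and that the discount factor is $\gamma=1$. Let $\hat v_R(s_0)=\frac1R\sum_{j=1}^R r_j$. Then for every rollout $i$ the advantage $\hat A_i(t)$ assigned to token position $t$ is the same scalar for all positions: $$\hat A_i(t)=r_i-\hat v_R(s_0)=:\hat A_i\qquad\text{for all } t\in\{0,\dots,T_i-1\},$$ and the per-token gradient contribution is $$\hat g_i(t)=\hat A_i\cdot\nabla_\theta\log\pi_\theta(a_t^{(i)}\mid s_t^{(i)}),$$ where the coefficient $\hat A_i$ depends on the group of $R$ rollouts but not on the token position $t$ within rollout $i$.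
   Context: Text generation is modelled as an episodic Markov decision process: a state $s_t$ is the concatenation of the prompt and the tokens generated so far, an action $a_t$ is a vocabulary token, and transitions are deterministic (concatenation). The policy $\pi_\theta(a\mid s)$ is a differentiable family of distributions over tokens with parameters $\theta\in\mathbb{R}^d$. For rollout $i$, the empirical (discounted) return from position $t$ is $$\hat G_t^{(i)}=\sum_{k=0}^{T_i-t-1}\gamma^k\, r(s_{t+k}^{(i)},a_{t+k}^{(i)}).$$ The advantage assigned by GRPO (Group Relative Policy Optimization) to position $t$ of rollout $i$ is the return minus the group-mean baseline, $\hat A_i(t)=\hat G_t^{(i)}-\hat v_R(s_0)$. The per-token gradient contribution is the corresponding term of the REINFORCE estimator with this baseline, $$\hat g_i(t)=\gamma^t\,\hat A_i(t)\,\nabla_\theta\log\pi_\theta(a_t^{(i)}\mid s_t^{(i)}).$$ *)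

theory Defs
  imports "HOL-Probability.Probability_Mass_Function"
begin

text \<open>
  A state is the token sequence consisting of the prompt and everything generated so far, so the
  deterministic transition on token \<open>a\<close> is \<open>s \<mapsto> s @ [a]\<close>.
  A rollout \<open>(s\<^sub>0, a\<^sub>0, \<dots>, s\<^bsub>T-1\<^esub>, a\<^bsub>T-1\<^esub>)\<close> is the list of its state-action pairs;
  its length \<open>T\<close> is the length of that list.
\<close>

type_synonym 'v state = "'v list"
type_synonym ('p, 'v) policy = "'p \<Rightarrow> 'v state \<Rightarrow> 'v pmf"
type_synonym 'v rollout = "('v state \<times> 'v) list"
type_synonym 'v reward = "'v state \<Rightarrow> 'v \<Rightarrow> real"

abbreviation state_at :: "'v rollout \<Rightarrow> nat \<Rightarrow> 'v state" where
  "state_at \<tau> t \<equiv> fst (\<tau> ! t)"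

abbreviation action_at :: "'v rollout \<Rightarrow> nat \<Rightarrow> 'v" where
  "action_at \<tau> t \<equiv> snd (\<tau> ! t)"

text \<open>
  The possible outcomes of sampling from the policy with parameters \<open>\<theta>\<close> at \<open>s0\<close>: each token is drawn
  from \<open>\<pi> \<theta> s\<^sub>t\<close>, i.e. has positive probability there. No rule for when an episode stops is fixed.
\<close>

definition is_rollout :: "('p, 'v) policy \<Rightarrow> 'p \<Rightarrow> 'v state \<Rightarrow> 'v rollout \<Rightarrow> bool" where
  "is_rollout \<pi> \<theta> s0 \<tau> \<longleftrightarrow>
     length \<tau> \<ge> 1 \<and> state_at \<tau> 0 = s0 \<and>
     (\<forall>t. Suc t < length \<tau> \<longrightarrow> state_at \<tau> (Suc t) = state_at \<tau> t @ [action_at \<tau> t]) \<and>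
     (\<forall>t < length \<tau>. action_at \<tau> t \<in> set_pmf (\<pi> \<theta> (state_at \<tau> t)))"

definition differentiable_policy :: "('p::real_normed_vector, 'v) policy \<Rightarrow> bool" where
  "differentiable_policy \<pi> \<longleftrightarrow>
     (\<forall>s a \<theta>. (\<lambda>\<theta>'. pmf (\<pi> \<theta>' s) a) differentiable (at \<theta>))"

definition empirical_return :: "real \<Rightarrow> 'v reward \<Rightarrow> 'v rollout \<Rightarrow> nat \<Rightarrow> real" where
  "empirical_return \<gamma> r \<tau> t =
     (\<Sum>k<length \<tau> - t. \<gamma> ^ k * r (state_at \<tau> (t + k)) (action_at \<tau> (t + k)))"

definition group_mean :: "nat \<Rightarrow> (nat \<Rightarrow> real) \<Rightarrow> real" where
  "group_mean R rs = 1 / real R * (\<Sum>j = 1..R. rs j)"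

definition advantage :: "real \<Rightarrow> 'v reward \<Rightarrow> real \<Rightarrow> 'v rollout \<Rightarrow> nat \<Rightarrow> real" where
  "advantage \<gamma> r v \<tau> t = empirical_return \<gamma> r \<tau> t - v"

text \<open>Meaningful only where \<open>f\<close> is differentiable.\<close>

definition gradient :: "('p::real_inner \<Rightarrow> real) \<Rightarrow> 'p \<Rightarrow> 'p" where
  "gradient f x = (THE D. GDERIV f x :> D)"

definition grad_log_prob :: "('p::real_inner, 'v) policy \<Rightarrow> 'p \<Rightarrow> 'v state \<Rightarrow> 'v \<Rightarrow> 'p" where
  "grad_log_prob \<pi> \<theta> s a = gradient (\<lambda>\<theta>'. ln (pmf (\<pi> \<theta>' s) a)) \<theta>"

definition grad_contribution ::
  "('p::real_inner, 'v) policy \<Rightarrow> 'p \<Rightarrow> real \<Rightarrow> 'v reward \<Rightarrow> real \<Rightarrow> 'v rollout \<Rightarrow> nat \<Rightarrow> 'p" where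
  "grad_contribution \<pi> \<theta> \<gamma> r v \<tau> t =
     (\<gamma> ^ t * advantage \<gamma> r v \<tau> t) *\<^sub>R grad_log_prob \<pi> \<theta> (state_at \<tau> t) (action_at \<tau> t)"

lemma GDERIV_unique:
  assumes "GDERIV f x :> D" "GDERIV f x :> E"
  shows "D = E"
proof -
  have "(\<lambda>h. inner h D) = (\<lambda>h. inner h E)"
    using assms unfolding gderiv_def by (rule has_derivative_unique)
  then have "inner (D - E) D = inner (D - E) E"
    by (rule fun_cong)
  then have "inner (D - E) (D - E) = 0"
    by (simp add: inner_diff_right)
  then show ?thesis
    by simp
qed

lemma GDERIV_gradient:
  fixes f :: "'p::euclidean_space \<Rightarrow> real"
  assumes "f differentiable (at x)"
  shows "GDERIV f x :> gradient f x"
proof -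
  obtain f' where f': "(f has_derivative f') (at x)"
    using assms by (auto simp: differentiable_def)
  then have lin: "linear f'"
    by (rule has_derivative_linear)
  have "f' = (\<lambda>h. inner h (\<Sum>b\<in>Basis. f' b *\<^sub>R b))"
  proof
    fix h
    have "f' h = f' (\<Sum>b\<in>Basis. inner h b *\<^sub>R b)"
      by (simp add: euclidean_representation)
    also have "\<dots> = inner h (\<Sum>b\<in>Basis. f' b *\<^sub>R b)"
      by (simp add: linear_sum[OF lin] linear_cmul[OF lin] inner_sum_right mult.commute)
    finally show "f' h = inner h (\<Sum>b\<in>Basis. f' b *\<^sub>R b)" .
  qed
  then have "GDERIV f x :> (\<Sum>b\<in>Basis. f' b *\<^sub>R b)"
    using f' unfolding gderiv_def by simp
  then show ?thesis
    unfolding gradient_def by (blast intro: theI GDERIV_unique)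
qed

text \<open>Along every rollout of a differentiable policy the score gradient exists.\<close>

lemma GDERIV_grad_log_prob:
  fixes \<pi> :: "('p::euclidean_space, 'v) policy"
  assumes "differentiable_policy \<pi>" "is_rollout \<pi> \<theta> s0 \<tau>" "t < length \<tau>"
  shows "GDERIV (\<lambda>\<theta>'. ln (pmf (\<pi> \<theta>' (state_at \<tau> t)) (action_at \<tau> t))) \<theta> :>
           grad_log_prob \<pi> \<theta> (state_at \<tau> t) (action_at \<tau> t)"
  unfolding grad_log_prob_def
proof (rule GDERIV_gradient)
  have pos: "pmf (\<pi> \<theta> (state_at \<tau> t)) (action_at \<tau> t) > 0"
    using assms(2,3) by (auto simp: is_rollout_def pmf_positive)
  obtain p' where "((\<lambda>\<theta>'. pmf (\<pi> \<theta>' (state_at \<tau> t)) (action_at \<tau> t)) has_derivative p') (at \<theta>)"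
    using assms(1) unfolding differentiable_policy_def differentiable_def by blast
  from has_derivative_ln[OF pos this]
  show "(\<lambda>\<theta>'. ln (pmf (\<pi> \<theta>' (state_at \<tau> t)) (action_at \<tau> t))) differentiable (at \<theta>)"
    by (rule differentiableI)
qed

end

theory Submission
  imports Defs
begin

text \<open>With output-only reward, every summand of the return from \<open>t\<close> vanishes
  except the one at the terminal position, so the return is the terminal reward discounted by the
  distance to it. At \<gamma> = 1 both this discount and the prefactor \<open>\<gamma> ^ t\<close>
  equal 1, which removes all dependence on \<open>t\<close> except through the score
  gradient.\<close>

lemma empirical_return_output_only:
  assumes "t < length \<tau>"
    and "\<And>u. u < length \<tau> - 1 \<Longrightarrow> r (state_at \<tau> u) (action_at \<tau> u) = 0"
  shows "empirical_return \<gamma> r \<tau> t =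
           \<gamma> ^ (length \<tau> - 1 - t) * r (state_at \<tau> (length \<tau> - 1)) (action_at \<tau> (length \<tau> - 1))"
proof -
  \<comment> \<open>\<open>n\<close> is the distance from \<open>t\<close> to the terminal position,
    hence the index of the last summand. Since \<open>t < length \<tau>\<close>, no natural-number
    subtraction truncates here.\<close>
  define n where "n = length \<tau> - 1 - t"
  have split: "length \<tau> - t = Suc n" and last: "t + n = length \<tau> - 1"
    using assms(1) by (simp_all add: n_def)
  have "(\<Sum>k<n. \<gamma> ^ k * r (state_at \<tau> (t + k)) (action_at \<tau> (t + k))) = 0"
    using assms(2) last by (intro sum.neutral) auto
  then show ?thesis
    unfolding empirical_return_def split n_def[symmetric] by (simp add: last)
qed

theorem theorem3p1:
  fixes \<pi> :: "(real ^ 'd, 'v) policy" and \<theta> :: "real ^ 'd"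
    and s0 :: "'v state" and R :: nat and \<tau> :: "nat \<Rightarrow> 'v rollout"
    and r :: "'v reward" and rs :: "nat \<Rightarrow> real" and \<gamma> :: real
  assumes policy: "differentiable_policy \<pi>"
    and R: "R \<ge> 1"
    and rollouts: "\<And>i. i \<in> {1..R} \<Longrightarrow> is_rollout \<pi> \<theta> s0 (\<tau> i)"
    and zero_reward: "\<And>i t. i \<in> {1..R} \<Longrightarrow> t < length (\<tau> i) - 1 \<Longrightarrow>
                        r (state_at (\<tau> i) t) (action_at (\<tau> i) t) = 0"
    and terminal_reward: "\<And>i. i \<in> {1..R} \<Longrightarrow>
                        r (state_at (\<tau> i) (length (\<tau> i) - 1)) (action_at (\<tau> i) (length (\<tau> i) - 1)) = rs i"
    and gamma: "\<gamma> = 1"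
  shows "\<forall>i\<in>{1..R}. let v = group_mean R rs; A = rs i - v in
           \<forall>t<length (\<tau> i).
             advantage \<gamma> r v (\<tau> i) t = A \<and>
             grad_contribution \<pi> \<theta> \<gamma> r v (\<tau> i) t =
               A *\<^sub>R grad_log_prob \<pi> \<theta> (state_at (\<tau> i) t) (action_at (\<tau> i) t)"
proof -
  \<comment> \<open>The baseline is only subtracted, so \<open>v\<close> can be arbitrary; the group
    mean is substituted at the end.\<close>
  have "advantage \<gamma> r v (\<tau> i) t = rs i - v" if "i \<in> {1..R}" "t < length (\<tau> i)" for i t v
    unfolding advantage_def
    using empirical_return_output_only[of t "\<tau> i" r \<gamma>, OF that(2) zero_reward[OF that(1)]]
    \<comment> \<open>\<open>One_nat_def\<close> would turn \<open>length (\<tau> i) - 1\<close>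
      into a form that \<open>terminal_reward\<close> no longer matches.\<close>
    by (simp add: gamma terminal_reward[OF that(1)] del: One_nat_def)
  then show ?thesis
    by (simp add: Let_def grad_contribution_def gamma)
qed

end
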